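(* Let $\varphi$ be a symbol for $S(\mathbb{R})$. If $C_{\varphi}:S(\mathbb{R})\to S(\mathbb{R})$, $f\mapsto f\circ\varphi$, has closed range, then $C_{\varphi}:C^\infty(\mathbb{R})\to C^{\infty}(\mathbb{R})$, $f\mapsto f\circ\varphi$, also has closed range.
   Context: All functions are real-valued. $C^{\infty}(\mathbb{R})$ is the Fréchet space of smooth functions $\mathbb{R}\to\mathbb{R}$ with the topology of uniform convergence of all derivatives on compact sets. $S(\mathbb{R})$ is the (real) Schwartz space of smooth functions $f:\mathbb{R}\to\mathbb{R}$ such that $\pi_n(f):=\sup_{x\in \mathbb{R}}\sup_{0\leq j\leq n}(1+|x|^2)^n|f^{(j)}(x)|<\infty$ for each $n\in\mathbb{N}$, endowed with the Fréchet topology generated by $(\pi_n)_{n}$. A function $\varphi\in C^\infty(\mathbb{R})$ is called a symbol for $S(\mathbb{R})$ if $f\circ\varphi\in S(\mathbb{R})$ whenever $f\in S(\mathbb{R})$. An operator has closed range if its image is a closed subset of the target space. *)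

theory Defs
  imports "HOL-Analysis.Analysis"
begin

definition smooth_functions :: "(real \<Rightarrow> real) set" where
  "smooth_functions = {f. \<forall>n. (deriv ^^ n) f differentiable_on UNIV}"

(* The seminorms are valued in the extended nonnegative reals, so that every supremum is
   meaningful and finiteness of a supremum can be stated literally. *)

definition schwartz_seminorm :: "nat \<Rightarrow> (real \<Rightarrow> real) \<Rightarrow> ennreal" where
  "schwartz_seminorm n f =
     (SUP x. SUP j\<in>{0..n}. ennreal ((1 + \<bar>x\<bar>\<^sup>2) ^ n * \<bar>(deriv ^^ j) f x\<bar>))"

definition schwartz_functions :: "(real \<Rightarrow> real) set" where
  "schwartz_functions = {f \<in> smooth_functions. \<forall>n. schwartz_seminorm n f < \<infinity>}"

definition compact_seminorm :: "real set \<times> nat \<Rightarrow> (real \<Rightarrow> real) \<Rightarrow> ennreal" where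
  "compact_seminorm = (\<lambda>(K, j) f. SUP x\<in>K. ennreal \<bar>(deriv ^^ j) f x\<bar>)"

(* The locally convex topology on X given by the seminorms p i, i in I: the p i-balls
   around the elements of X form a subbase. *)

definition seminorm_topology ::
  "(real \<Rightarrow> real) set \<Rightarrow> 'i set \<Rightarrow> ('i \<Rightarrow> (real \<Rightarrow> real) \<Rightarrow> ennreal) \<Rightarrow> (real \<Rightarrow> real) topology" where
  "seminorm_topology X I p = topology_generated_by
     {{g \<in> X. p i (\<lambda>x. g x - f x) < ennreal e} | f i e. f \<in> X \<and> i \<in> I \<and> 0 < e}"

definition smooth_topology :: "(real \<Rightarrow> real) topology" where
  "smooth_topology = seminorm_topology smooth_functions ({K. compact K} \<times> UNIV) compact_seminorm"

definition schwartz_topology :: "(real \<Rightarrow> real) topology" where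
  "schwartz_topology = seminorm_topology schwartz_functions UNIV schwartz_seminorm"

definition schwartz_symbol :: "(real \<Rightarrow> real) \<Rightarrow> bool" where
  "schwartz_symbol \<phi> \<longleftrightarrow>
     \<phi> \<in> smooth_functions \<and> (\<forall>f \<in> schwartz_functions. f \<circ> \<phi> \<in> schwartz_functions)"

definition composition_operator :: "(real \<Rightarrow> real) \<Rightarrow> (real \<Rightarrow> real) \<Rightarrow> (real \<Rightarrow> real)" where
  "composition_operator \<phi> f = f \<circ> \<phi>"

definition has_closed_range :: "'a topology \<Rightarrow> 'b topology \<Rightarrow> ('a \<Rightarrow> 'b) \<Rightarrow> bool" where
  "has_closed_range S T A \<longleftrightarrow> closedin T (A ` topspace S)"

lemma topspace_seminorm_topology:
  assumes "I \<noteq> {}" and "\<And>i. i \<in> I \<Longrightarrow> p i (\<lambda>x. 0) = 0"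
  shows "topspace (seminorm_topology X I p) = X"
proof
  show "topspace (seminorm_topology X I p) \<subseteq> X"
    by (auto simp: seminorm_topology_def)
  show "X \<subseteq> topspace (seminorm_topology X I p)"
  proof
    fix f assume f: "f \<in> X"
    obtain i where i: "i \<in> I" using assms(1) by blast
    have "f \<in> {g \<in> X. p i (\<lambda>x. g x - f x) < ennreal 1}"
      using f assms(2)[OF i] by simp
    moreover have "{g \<in> X. p i (\<lambda>x. g x - f x) < ennreal 1} \<in>
      {{g \<in> X. p i (\<lambda>x. g x - f x) < ennreal e} | f i e. f \<in> X \<and> i \<in> I \<and> 0 < e}"
      using f i zero_less_one[where 'a=real] by blast
    ultimately show "f \<in> topspace (seminorm_topology X I p)"
      unfolding seminorm_topology_def topology_generated_by_topspace by blast
  qed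
qed

lemma higher_deriv_zero: "(deriv ^^ n) (\<lambda>x::real. 0::real) = (\<lambda>x. 0)"
  by (induction n) auto

lemma topspace_smooth_topology [simp]: "topspace smooth_topology = smooth_functions"
  unfolding smooth_topology_def
proof (rule topspace_seminorm_topology)
  show "{K :: real set. compact K} \<times> (UNIV :: nat set) \<noteq> {}"
    using compact_empty by blast
  show "compact_seminorm i (\<lambda>x. 0) = 0" for i
    by (cases i) (auto simp: compact_seminorm_def higher_deriv_zero bot_ennreal SUP_constant)
qed

lemma topspace_schwartz_topology [simp]: "topspace schwartz_topology = schwartz_functions"
  unfolding schwartz_topology_def
  by (rule topspace_seminorm_topology) (auto simp: schwartz_seminorm_def higher_deriv_zero)

end

theory Submission
  imports Defs
begin

text \<open>
  A symbol \<open>\<phi>\<close> is proper: composing \<open>\<phi>\<close> with a cutoff that equals 1 on \<open>[-r, r]\<close> yields a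
  decaying function, so the preimage of \<open>[-r, r]\<close> is bounded. Hence, for cutoffs \<open>\<kappa> n\<close> with
  \<open>\<kappa> n = 1\<close> on \<open>[-n, n]\<close>, the functions \<open>\<kappa> n \<circ> \<phi>\<close> have compact support, and multiplication by them
  is continuous from the smooth functions to the Schwartz functions. A smooth \<open>g\<close> factors
  smoothly through \<open>\<phi>\<close> if and only if every \<open>(\<kappa> n \<circ> \<phi>) g\<close> lies in the range of the
  composition operator on the Schwartz space: the factors \<open>h n\<close> of these products can be glued.
  So the range on the smooth functions is an intersection of preimages of a closed set.
\<close>

section \<open>Calculus of smooth functions on the line\<close>

text \<open>A finite order gives the closure properties of smooth functions something to induct on:
  differentiating a compound expression yields expressions in functions of one order less. The
  strict bound makes order 0 an empty condition, so the base cases are trivial.\<close>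

definition times_differentiable :: "nat \<Rightarrow> (real \<Rightarrow> real) \<Rightarrow> bool" where
  "times_differentiable n f \<longleftrightarrow> (\<forall>k<n. (deriv ^^ k) f differentiable_on UNIV)"

lemma smooth_iff_times_differentiable:
  "f \<in> smooth_functions \<longleftrightarrow> (\<forall>n. times_differentiable n f)"
  unfolding smooth_functions_def times_differentiable_def by blast

lemma times_differentiable_0 [simp]: "times_differentiable 0 f"
  by (simp add: times_differentiable_def)

lemma times_differentiable_Suc:
  "times_differentiable (Suc n) f \<longleftrightarrow> f differentiable_on UNIV \<and> times_differentiable n (deriv f)"
  unfolding times_differentiable_def All_less_Suc2 by (simp add: funpow_Suc_right del: funpow.simps)

text \<open>Lets an explicit formula \<open>D\<close> stand for the derivative, so the inductions
  below never have to evaluate \<open>deriv\<close> of a compound function.\<close>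

lemma times_differentiable_SucI:
  assumes "\<And>x. (f has_real_derivative D x) (at x)" and "times_differentiable n D"
  shows "times_differentiable (Suc n) f"
proof -
  have "deriv f = D"
    using assms(1) DERIV_imp_deriv by blast
  moreover have "f differentiable_on UNIV"
    by (meson assms(1) differentiable_at_imp_differentiable_on real_differentiable_def)
  ultimately show ?thesis
    using assms(2) by (simp add: times_differentiable_Suc)
qed

lemma times_differentiable_SucD:
  assumes "times_differentiable (Suc n) f"
  shows "(f has_real_derivative deriv f x) (at x)" "times_differentiable n (deriv f)"
    "times_differentiable n f"
proof -
  show "(f has_real_derivative deriv f x) (at x)" "times_differentiable n (deriv f)"
    using assms by (simp_all add: times_differentiable_Suc differentiable_on_def
        DERIV_deriv_iff_real_differentiable)
  show "times_differentiable n f"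
    using assms unfolding times_differentiable_def by (meson less_SucI)
qed

lemma times_differentiable_const: "times_differentiable n (\<lambda>x. c)"
proof (induction n arbitrary: c)
  case (Suc n)
  show ?case
    by (rule times_differentiable_SucI[where D = "\<lambda>x. 0"]) (auto intro: Suc)
qed simp

lemma times_differentiable_add:
  "times_differentiable n f \<Longrightarrow> times_differentiable n g \<Longrightarrow> times_differentiable n (\<lambda>x. f x + g x)"
proof (induction n arbitrary: f g)
  case (Suc n)
  note f = times_differentiable_SucD[OF Suc.prems(1)] and g = times_differentiable_SucD[OF Suc.prems(2)]
  show ?case
    by (rule times_differentiable_SucI[where D = "\<lambda>x. deriv f x + deriv g x"])
      (auto intro!: derivative_intros Suc.IH f g)
qed simp

lemma times_differentiable_mult:
  "times_differentiable n f \<Longrightarrow> times_differentiable n g \<Longrightarrow> times_differentiable n (\<lambda>x. f x * g x)"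
proof (induction n arbitrary: f g)
  case (Suc n)
  note f = times_differentiable_SucD[OF Suc.prems(1)] and g = times_differentiable_SucD[OF Suc.prems(2)]
  show ?case
    by (rule times_differentiable_SucI[where D = "\<lambda>x. deriv f x * g x + f x * deriv g x"])
      (auto intro!: derivative_eq_intros times_differentiable_add Suc.IH f g)
qed simp

text \<open>The chain rule produces \<open>deriv f\<close> composed with the same \<open>g\<close>,
  times \<open>deriv g\<close>. Hence the induction varies \<open>f\<close> only.\<close>

lemma times_differentiable_compose:
  "times_differentiable n f \<Longrightarrow> times_differentiable n g \<Longrightarrow> times_differentiable n (\<lambda>x. f (g x))"
proof (induction n arbitrary: f)
  case (Suc n)
  note f = times_differentiable_SucD[OF Suc.prems(1)] and g = times_differentiable_SucD[OF Suc.prems(2)]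
  show ?case
    by (rule times_differentiable_SucI[where D = "\<lambda>x. deriv f (g x) * deriv g x"])
      (intro DERIV_chain2[where f = f] f g times_differentiable_mult Suc.IH)+
qed simp

lemma times_differentiable_inverse:
  assumes "\<And>x. f x \<noteq> 0"
  shows "times_differentiable n f \<Longrightarrow> times_differentiable n (\<lambda>x. inverse (f x))"
proof (induction n)
  case (Suc n)
  note f = times_differentiable_SucD[OF Suc.prems]
  show ?case
  proof (rule times_differentiable_SucI)
    \<comment> \<open>The derivative \<open>- f' / f^2\<close> is written as a product in which the
      induction hypothesis covers both factors \<open>inverse (f x)\<close>.\<close>
    show "times_differentiable n (\<lambda>x. (-1) * deriv f x * (inverse (f x) * inverse (f x)))"
      by (intro times_differentiable_mult times_differentiable_const f Suc.IH)
    show "((\<lambda>x. inverse (f x)) has_real_derivative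
        (-1) * deriv f x * (inverse (f x) * inverse (f x))) (at x)" for x
      by (auto intro!: derivative_eq_intros f simp: assms)
  qed
qed simp

lemma smooth_const: "(\<lambda>x. c) \<in> smooth_functions"
  by (simp add: smooth_iff_times_differentiable times_differentiable_const)

lemma smooth_id: "(\<lambda>x. x) \<in> smooth_functions"
  unfolding smooth_iff_times_differentiable
proof
  show "times_differentiable n (\<lambda>x. x)" for n
    by (cases n) (auto intro!: times_differentiable_SucI[where D = "\<lambda>x. 1"] times_differentiable_const)
qed

lemma smooth_add:
  "f \<in> smooth_functions \<Longrightarrow> g \<in> smooth_functions \<Longrightarrow> (\<lambda>x. f x + g x) \<in> smooth_functions"
  by (simp add: smooth_iff_times_differentiable times_differentiable_add)

lemma smooth_mult:
  "f \<in> smooth_functions \<Longrightarrow> g \<in> smooth_functions \<Longrightarrow> (\<lambda>x. f x * g x) \<in> smooth_functions"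
  by (simp add: smooth_iff_times_differentiable times_differentiable_mult)

lemma smooth_compose:
  "f \<in> smooth_functions \<Longrightarrow> g \<in> smooth_functions \<Longrightarrow> (\<lambda>x. f (g x)) \<in> smooth_functions"
  by (simp add: smooth_iff_times_differentiable times_differentiable_compose)

lemma smooth_inverse:
  "f \<in> smooth_functions \<Longrightarrow> (\<And>x. f x \<noteq> 0) \<Longrightarrow> (\<lambda>x. inverse (f x)) \<in> smooth_functions"
  by (simp add: smooth_iff_times_differentiable times_differentiable_inverse)

lemma smooth_diff:
  assumes "f \<in> smooth_functions" and "g \<in> smooth_functions"
  shows "(\<lambda>x. f x - g x) \<in> smooth_functions"
  using smooth_add[OF assms(1) smooth_mult[OF smooth_const[of "-1"] assms(2)]] by simp

lemma smooth_deriv: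
  assumes "f \<in> smooth_functions"
  shows "deriv f \<in> smooth_functions" "(f has_real_derivative deriv f x) (at x)"
  using assms times_differentiable_SucD(1,2) unfolding smooth_iff_times_differentiable by blast+

lemma smooth_higher_deriv: "f \<in> smooth_functions \<Longrightarrow> (deriv ^^ n) f \<in> smooth_functions"
  by (induction n) (auto intro: smooth_deriv)

lemma continuous_on_smooth: "f \<in> smooth_functions \<Longrightarrow> continuous_on S f"
  using DERIV_continuous_on smooth_deriv(2) has_field_derivative_at_within by blast

lemma higher_deriv_add:
  assumes "f \<in> smooth_functions" and "g \<in> smooth_functions"
  shows "(deriv ^^ n) (\<lambda>x. f x + g x) = (\<lambda>x. (deriv ^^ n) f x + (deriv ^^ n) g x)"
proof (induction n)
  case (Suc n)
  have "((\<lambda>x. (deriv ^^ n) f x + (deriv ^^ n) g x) has_real_derivative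
      deriv ((deriv ^^ n) f) x + deriv ((deriv ^^ n) g) x) (at x)" for x
    by (intro DERIV_add smooth_deriv smooth_higher_deriv assms)
  then show ?case
    using Suc by (auto intro!: DERIV_imp_deriv)
qed simp

text \<open>Derivatives depend only on germs. This is what makes a function glued from smooth pieces
  smooth.\<close>

lemma smooth_if_locally_smooth:
  assumes "\<And>x. \<exists>g \<in> smooth_functions. \<forall>\<^sub>F y in nhds x. f y = g y"
  shows "f \<in> smooth_functions"
  unfolding smooth_functions_def differentiable_on_def
proof safe
  fix n x
  obtain g where g: "g \<in> smooth_functions" "\<forall>\<^sub>F y in nhds x. f y = g y"
    using assms by blast
  have "((deriv ^^ n) g has_real_derivative deriv ((deriv ^^ n) g) x) (at x)"
    by (intro smooth_deriv smooth_higher_deriv g)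
  \<comment> \<open>Agreement near \<open>x\<close> is agreement near every point close to
    \<open>x\<close>, so the \<open>n\<close>-th derivatives coincide on a neighborhood and can be
    differentiated once more.\<close>
  moreover have "\<forall>\<^sub>F y in nhds x. (deriv ^^ n) f y = (deriv ^^ n) g y"
    using eventually_eventually[of "\<lambda>y. f y = g y" x] g(2)
    by (auto elim!: eventually_mono intro: higher_deriv_cong_ev)
  ultimately have "((deriv ^^ n) f has_real_derivative deriv ((deriv ^^ n) g) x) (at x)"
    using DERIV_cong_ev by blast
  then show "(deriv ^^ n) f differentiable at x"
    using real_differentiable_def by blast
qed

lemma higher_deriv_eq_0_outside:
  fixes f :: "real \<Rightarrow> real"
  assumes "closed K" and "\<And>x. x \<notin> K \<Longrightarrow> f x = 0" and "x \<notin> K"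
  shows "(deriv ^^ n) f x = 0"
proof -
  have "\<forall>\<^sub>F y in nhds x. y \<in> - K"
    using assms by (intro eventually_nhds_in_open) auto
  then have "\<forall>\<^sub>F y in nhds x. f y = 0"
    by (rule eventually_mono) (use assms(2) in auto)
  from higher_deriv_cong_ev[OF this refl] show ?thesis
    by (simp add: higher_deriv_zero)
qed

text \<open>A qualitative form of the Leibniz rule with \<open>C\<close> independent of
  \<open>v\<close>. Since \<open>(\<theta> v)' = \<theta>' v + \<theta> v'\<close>, the induction
  hypothesis is applied to \<open>deriv \<theta>\<close> with \<open>v\<close> and to
  \<open>\<theta>\<close> with \<open>deriv v\<close>.\<close>

lemma higher_deriv_mult_bound:
  assumes "compact K" and "\<theta> \<in> smooth_functions"
  shows "\<exists>C\<ge>0. \<forall>v\<in>smooth_functions. \<forall>x\<in>K.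
    \<bar>(deriv ^^ n) (\<lambda>x. \<theta> x * v x) x\<bar> \<le> C * (\<Sum>k\<le>n. \<bar>(deriv ^^ k) v x\<bar>)"
  using assms(2)
proof (induction n arbitrary: \<theta>)
  case 0
  have "bounded (\<theta> ` K)"
    using assms(1) 0 by (intro compact_imp_bounded compact_continuous_image continuous_on_smooth)
  then obtain C where "C > 0" "\<forall>x\<in>K. \<bar>\<theta> x\<bar> \<le> C"
    unfolding bounded_pos by auto
  then show ?case
    by (intro exI[of _ C]) (auto simp: abs_mult intro!: mult_right_mono)
next
  case (Suc n)
  obtain A where A: "A \<ge> 0" "\<And>v x. v \<in> smooth_functions \<Longrightarrow> x \<in> K \<Longrightarrow>
      \<bar>(deriv ^^ n) (\<lambda>x. deriv \<theta> x * v x) x\<bar> \<le> A * (\<Sum>k\<le>n. \<bar>(deriv ^^ k) v x\<bar>)"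
    using Suc.IH[OF smooth_deriv(1)[OF Suc.prems]] by blast
  obtain B where B: "B \<ge> 0" "\<And>v x. v \<in> smooth_functions \<Longrightarrow> x \<in> K \<Longrightarrow>
      \<bar>(deriv ^^ n) (\<lambda>x. \<theta> x * v x) x\<bar> \<le> B * (\<Sum>k\<le>n. \<bar>(deriv ^^ k) v x\<bar>)"
    using Suc.IH[OF Suc.prems] by blast
  have "\<bar>(deriv ^^ Suc n) (\<lambda>x. \<theta> x * v x) x\<bar> \<le> (A + B) * (\<Sum>k\<le>Suc n. \<bar>(deriv ^^ k) v x\<bar>)"
    if v: "v \<in> smooth_functions" and x: "x \<in> K" for v x
  proof -
    have "deriv (\<lambda>x. \<theta> x * v x) = (\<lambda>x. deriv \<theta> x * v x + \<theta> x * deriv v x)"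
      by (auto intro!: DERIV_imp_deriv derivative_eq_intros smooth_deriv v Suc.prems)
    then have *: "(deriv ^^ Suc n) (\<lambda>x. \<theta> x * v x) x =
        (deriv ^^ n) (\<lambda>x. deriv \<theta> x * v x) x + (deriv ^^ n) (\<lambda>x. \<theta> x * deriv v x) x"
      by (simp add: funpow_Suc_right higher_deriv_add smooth_mult smooth_deriv v Suc.prems
          del: funpow.simps)
    have "\<bar>(deriv ^^ Suc n) (\<lambda>x. \<theta> x * v x) x\<bar> \<le> A * (\<Sum>k\<le>n. \<bar>(deriv ^^ k) v x\<bar>) + B * (\<Sum>k\<le>n. \<bar>(deriv ^^ k) (deriv v) x\<bar>)"
      unfolding * using A(2)[OF v x] B(2)[OF smooth_deriv(1)[OF v] x] by linarith
    also have "\<dots> \<le> A * (\<Sum>k\<le>Suc n. \<bar>(deriv ^^ k) v x\<bar>) + B * (\<Sum>k\<le>Suc n. \<bar>(deriv ^^ k) v x\<bar>)"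
    proof (intro add_mono mult_left_mono A(1) B(1))
      \<comment> \<open>The left side consists of the derivatives of \<open>v\<close> of orders 1 to
        \<open>Suc n\<close>; the right side has the term of order 0 in addition.\<close>
      show "(\<Sum>k\<le>n. \<bar>(deriv ^^ k) (deriv v) x\<bar>) \<le> (\<Sum>k\<le>Suc n. \<bar>(deriv ^^ k) v x\<bar>)"
        unfolding sum.atMost_Suc_shift by (simp add: funpow_Suc_right del: funpow.simps)
    qed simp
    finally show ?thesis
      by (simp add: distrib_right)
  qed
  then show ?case
    using A(1) B(1) by (intro exI[of _ "A + B"]) auto
qed


section \<open>Construction of smooth cutoffs\<close>

text \<open>The factor \<open>inverse x ^ k\<close> makes this family closed under differentiation, up to linear combinations.\<close>

definition flat :: "nat \<Rightarrow> real \<Rightarrow> real" where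
  "flat k x = (if x \<le> 0 then 0 else inverse x ^ k * exp (- inverse x))"

text \<open>To the right of 0 the substitution \<open>t = inverse x\<close> turns the claim into the
  decay of \<open>t ^ k / exp t\<close> at infinity.\<close>

lemma tendsto_flat: "(flat k \<longlongrightarrow> 0) (at 0)"
proof (rule filterlim_split_at)
  have "\<forall>\<^sub>F x in at_left (0::real). x < 0"
    by (simp add: eventually_at_filter)
  then have "\<forall>\<^sub>F x in at_left 0. flat k x = 0"
    by (rule eventually_mono) (simp add: flat_def)
  then show "(flat k \<longlongrightarrow> 0) (at_left 0)"
    by (rule tendsto_eventually)
  have "((\<lambda>x::real. inverse x ^ k / exp (inverse x)) \<longlongrightarrow> 0) (at_right 0)"
    by (rule filterlim_compose[OF tendsto_power_div_exp_0 filterlim_inverse_at_top_right])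
  moreover have "\<forall>\<^sub>F x in at_right (0::real). x > 0"
    by (simp add: eventually_at_filter)
  then have "\<forall>\<^sub>F x in at_right 0. inverse x ^ k / exp (inverse x) = flat k x"
    by (rule eventually_mono) (simp add: flat_def exp_minus divide_inverse)
  ultimately show "(flat k \<longlongrightarrow> 0) (at_right 0)"
    by (rule Lim_transform_eventually)
qed

lemma DERIV_flat:
  "(flat k has_real_derivative flat (k + 2) x + (- real k) * flat (k + 1) x) (at x)"
proof (cases x "0 :: real" rule: linorder_cases)
  case less
  have "((\<lambda>x. 0) has_real_derivative flat (k + 2) x + (- real k) * flat (k + 1) x) (at x)"
    using less by (auto simp: flat_def)
  then show ?thesis
    by (rule has_field_derivative_transform_within_open[where S = "{..<0}"])
      (use less in \<open>auto simp: flat_def\<close>)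
next
  case equal
  \<comment> \<open>As \<open>flat k 0 = 0\<close>, dividing by \<open>h\<close> only raises the
    power by one: the difference quotient at 0 is \<open>flat (k + 1)\<close>, which tends to
    0.\<close>
  have "\<forall>\<^sub>F h in at 0. flat (k + 1) h = (flat k (0 + h) - flat k 0) / h"
    by (auto simp: flat_def field_simps intro!: always_eventually)
  then show ?thesis
    unfolding DERIV_def using equal Lim_transform_eventually[OF tendsto_flat[of "k + 1"]]
    by (simp add: flat_def)
next
  case greater
  have power: "x * x ^ (m - Suc 0) = x ^ m" if "m \<noteq> 0" for m
    using that by (cases m) auto
  have "((\<lambda>x. inverse x ^ k * exp (- inverse x)) has_real_derivative
      flat (k + 2) x + (- real k) * flat (k + 1) x) (at x)"
    using greater
    by (cases k; auto intro!: derivative_eq_intros simp: flat_def field_simps; metis power)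
  then show ?thesis
    by (rule has_field_derivative_transform_within_open[where S = "{0<..}"])
      (use greater in \<open>auto simp: flat_def\<close>)
qed

lemma smooth_flat: "flat k \<in> smooth_functions"
  unfolding smooth_iff_times_differentiable
proof
  show "times_differentiable n (flat k)" for n
  proof (induction n arbitrary: k)
    case (Suc n)
    show ?case
      by (rule times_differentiable_SucI[OF DERIV_flat])
        (intro times_differentiable_add times_differentiable_mult times_differentiable_const Suc.IH)
  qed simp
qed

lemma exists_smooth_step:
  "\<exists>s\<in>smooth_functions. (\<forall>y\<le>0. s y = 0) \<and> (\<forall>y\<ge>1. s y = 1)"
proof -
  define s where "s = (\<lambda>y. flat 0 y * inverse (flat 0 y + flat 0 (1 - y)))"
  \<comment> \<open>At least one of \<open>y\<close> and \<open>1 - y\<close> is positive, so the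
    two nonnegative summands never vanish together.\<close>
  have "flat 0 y + flat 0 (1 - y) > 0" for y
    by (auto simp: flat_def add_pos_pos)
  then have "s \<in> smooth_functions"
    unfolding s_def
    by (intro smooth_mult smooth_inverse smooth_add smooth_flat
        smooth_compose[OF smooth_flat smooth_diff[OF smooth_const smooth_id]]) (metis less_irrefl)
  then show ?thesis
    by (intro bexI[of _ s]) (auto simp: s_def flat_def)
qed

text \<open>The product of a step rising on \<open>[-r - 1, -r]\<close> and a step falling on
  \<open>[r, r + 1]\<close> serves as cutoff.\<close>

lemma exists_smooth_cutoff:
  "\<exists>\<kappa>\<in>smooth_functions. (\<forall>y. \<bar>y\<bar> \<le> r \<longrightarrow> \<kappa> y = 1) \<and> (\<forall>y. \<bar>y\<bar> \<ge> r + 1 \<longrightarrow> \<kappa> y = 0)"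
proof -
  obtain s where s: "s \<in> smooth_functions" "\<And>y. y \<le> 0 \<Longrightarrow> s y = 0" "\<And>y. y \<ge> 1 \<Longrightarrow> s y = 1"
    using exists_smooth_step by blast
  have "(\<lambda>y. s (r + 1 - y) * s (r + 1 + y)) \<in> smooth_functions"
    by (intro smooth_mult smooth_compose[OF s(1)] smooth_diff smooth_add smooth_const smooth_id)
  moreover have "s (r + 1 - y) * s (r + 1 + y) = 1" if "\<bar>y\<bar> \<le> r" for y
    using that s(3)[of "r + 1 - y"] s(3)[of "r + 1 + y"] by auto
  moreover have "s (r + 1 - y) * s (r + 1 + y) = 0" if "\<bar>y\<bar> \<ge> r + 1" for y
    using that s(2)[of "r + 1 - y"] s(2)[of "r + 1 + y"] by (cases "y \<ge> 0") auto
  ultimately show ?thesis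
    by (intro bexI[of _ "\<lambda>y. s (r + 1 - y) * s (r + 1 + y)"]) simp_all
qed

section \<open>Multiplication by compactly supported functions as a map into the Schwartz
  space\<close>

lemma compact_seminorm_finite:
  assumes "compact K" and "v \<in> smooth_functions"
  shows "compact_seminorm (K, k) v < \<infinity>"
proof -
  have "bounded ((deriv ^^ k) v ` K)"
    using assms by (intro compact_imp_bounded compact_continuous_image continuous_on_smooth
        smooth_higher_deriv)
  then obtain C where "\<forall>x\<in>K. \<bar>(deriv ^^ k) v x\<bar> \<le> C"
    unfolding bounded_pos by auto
  then have "compact_seminorm (K, k) v \<le> ennreal C"
    unfolding compact_seminorm_def by (auto intro!: SUP_least ennreal_leI)
  then show ?thesis
    using ennreal_less_top le_less_trans by (metis infinity_ennreal_def)
qed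

lemma schwartz_seminorm_triangle:
  assumes "f \<in> smooth_functions" and "g \<in> smooth_functions"
  shows "schwartz_seminorm n (\<lambda>x. f x + g x) \<le> schwartz_seminorm n f + schwartz_seminorm n g"
  unfolding schwartz_seminorm_def[of n "\<lambda>x. f x + g x"]
proof (intro SUP_least)
  fix x j assume j: "j \<in> {0..n}"
  have le: "ennreal ((1 + \<bar>x\<bar>\<^sup>2) ^ n * \<bar>(deriv ^^ j) u x\<bar>) \<le> schwartz_seminorm n u" for u
    unfolding schwartz_seminorm_def by (rule SUP_upper2[OF UNIV_I], rule SUP_upper[OF j])
  have "ennreal ((1 + \<bar>x\<bar>\<^sup>2) ^ n * \<bar>(deriv ^^ j) (\<lambda>x. f x + g x) x\<bar>) \<le>
    ennreal ((1 + \<bar>x\<bar>\<^sup>2) ^ n * \<bar>(deriv ^^ j) f x\<bar> + (1 + \<bar>x\<bar>\<^sup>2) ^ n * \<bar>(deriv ^^ j) g x\<bar>)"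
    unfolding higher_deriv_add[OF assms] distrib_left[symmetric]
    by (intro ennreal_leI mult_left_mono abs_triangle_ineq) simp
  also have "\<dots> = ennreal ((1 + \<bar>x\<bar>\<^sup>2) ^ n * \<bar>(deriv ^^ j) f x\<bar>) +
      ennreal ((1 + \<bar>x\<bar>\<^sup>2) ^ n * \<bar>(deriv ^^ j) g x\<bar>)"
    by (intro ennreal_plus) simp_all
  also have "\<dots> \<le> schwartz_seminorm n f + schwartz_seminorm n g"
    by (intro add_mono le)
  finally show "ennreal ((1 + \<bar>x\<bar>\<^sup>2) ^ n * \<bar>(deriv ^^ j) (\<lambda>x. f x + g x) x\<bar>) \<le>
      schwartz_seminorm n f + schwartz_seminorm n g" .
qed

text \<open>Off \<open>K\<close> the product vanishes with all its derivatives, and on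
  \<open>K\<close> the polynomial weight is bounded. This is the estimate behind the continuity of
  multiplication by \<open>\<theta>\<close>.\<close>

lemma schwartz_seminorm_mult_le:
  assumes "compact K" and "\<theta> \<in> smooth_functions" and "\<And>x. x \<notin> K \<Longrightarrow> \<theta> x = 0"
  shows "\<exists>C\<ge>0. \<forall>v\<in>smooth_functions. schwartz_seminorm n (\<lambda>x. \<theta> x * v x) \<le>
    ennreal C * (\<Sum>k\<le>n. compact_seminorm (K, k) v)"
proof -
  have "\<forall>j. \<exists>C. C \<ge> 0 \<and> (\<forall>v\<in>smooth_functions. \<forall>x\<in>K.
      \<bar>(deriv ^^ j) (\<lambda>x. \<theta> x * v x) x\<bar> \<le> C * (\<Sum>k\<le>j. \<bar>(deriv ^^ k) v x\<bar>))"
    using higher_deriv_mult_bound[OF assms(1,2)] by blast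
  from choice[OF this] obtain C where C: "\<And>j. C j \<ge> 0"
    "\<And>j v x. v \<in> smooth_functions \<Longrightarrow> x \<in> K \<Longrightarrow>
      \<bar>(deriv ^^ j) (\<lambda>x. \<theta> x * v x) x\<bar> \<le> C j * (\<Sum>k\<le>j. \<bar>(deriv ^^ k) v x\<bar>)"
    by blast
  have "bounded ((\<lambda>x. (1 + \<bar>x\<bar>\<^sup>2) ^ n) ` K)"
    using assms(1) by (intro compact_imp_bounded compact_continuous_image continuous_intros)
  then obtain B where B: "B > 0" "\<And>x. x \<in> K \<Longrightarrow> (1 + \<bar>x\<bar>\<^sup>2) ^ n \<le> B"
    unfolding bounded_pos by fastforce
  \<comment> \<open>\<open>B\<close> bounds the weight on \<open>K\<close>; summing the
    \<open>C j\<close> gives one constant that serves all orders \<open>j \<le> n\<close>.\<close>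
  define D where "D = B * (\<Sum>j\<le>n. C j)"
  have D: "D \<ge> 0"
    using B(1) C(1) by (simp add: D_def sum_nonneg)
  have "ennreal ((1 + \<bar>x\<bar>\<^sup>2) ^ n * \<bar>(deriv ^^ j) (\<lambda>x. \<theta> x * v x) x\<bar>) \<le>
      ennreal D * (\<Sum>k\<le>n. compact_seminorm (K, k) v)"
    if v: "v \<in> smooth_functions" and j: "j \<in> {0..n}" for v x j
  proof (cases "x \<in> K")
    case True
    have "(1 + \<bar>x\<bar>\<^sup>2) ^ n * \<bar>(deriv ^^ j) (\<lambda>x. \<theta> x * v x) x\<bar> \<le>
        B * (C j * (\<Sum>k\<le>j. \<bar>(deriv ^^ k) v x\<bar>))"
      using B C(2)[OF v True] True by (intro mult_mono) auto
    also have "\<dots> \<le> B * ((\<Sum>j\<le>n. C j) * (\<Sum>k\<le>n. \<bar>(deriv ^^ k) v x\<bar>))"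
      using B(1) C(1) j
      by (intro mult_left_mono mult_mono member_le_sum sum_mono2 sum_nonneg) auto
    finally have "ennreal ((1 + \<bar>x\<bar>\<^sup>2) ^ n * \<bar>(deriv ^^ j) (\<lambda>x. \<theta> x * v x) x\<bar>) \<le>
        ennreal (D * (\<Sum>k\<le>n. \<bar>(deriv ^^ k) v x\<bar>))"
      by (intro ennreal_leI) (simp add: D_def mult.assoc)
    also have "\<dots> = ennreal D * (\<Sum>k\<le>n. ennreal \<bar>(deriv ^^ k) v x\<bar>)"
      using D by (simp add: ennreal_mult sum_nonneg)
    also have "\<dots> \<le> ennreal D * (\<Sum>k\<le>n. compact_seminorm (K, k) v)"
      unfolding compact_seminorm_def using True
      by (intro mult_left_mono sum_mono) (auto intro: SUP_upper)
    finally show ?thesis .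
  next
    case False
    have "(deriv ^^ j) (\<lambda>x. \<theta> x * v x) x = 0"
      by (rule higher_deriv_eq_0_outside[OF compact_imp_closed[OF assms(1)] _ False])
        (simp add: assms(3))
    then show ?thesis by simp
  qed
  then have "schwartz_seminorm n (\<lambda>x. \<theta> x * v x) \<le>
      ennreal D * (\<Sum>k\<le>n. compact_seminorm (K, k) v)" if "v \<in> smooth_functions" for v
    unfolding schwartz_seminorm_def using that by (intro SUP_least)
  then show ?thesis
    using D by (intro exI[of _ D]) simp
qed

lemma compactly_supported_mult_schwartz:
  assumes "compact K" and "\<theta> \<in> smooth_functions" and "\<And>x. x \<notin> K \<Longrightarrow> \<theta> x = 0"
    and "v \<in> smooth_functions"
  shows "(\<lambda>x. \<theta> x * v x) \<in> schwartz_functions"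
  unfolding schwartz_functions_def
proof (intro CollectI conjI allI)
  show "(\<lambda>x. \<theta> x * v x) \<in> smooth_functions"
    by (intro smooth_mult assms)
  fix n
  obtain C where "schwartz_seminorm n (\<lambda>x. \<theta> x * v x) \<le>
      ennreal C * (\<Sum>k\<le>n. compact_seminorm (K, k) v)"
    using schwartz_seminorm_mult_le[OF assms(1-3)] assms(4) by blast
  also have "\<dots> < \<infinity>"
    using compact_seminorm_finite[OF assms(1,4)] by (auto simp: ennreal_mult_less_top)
  finally show "schwartz_seminorm n (\<lambda>x. \<theta> x * v x) < \<infinity>" .
qed

text \<open>It suffices to treat preimages of subbasic balls. Linearity and the seminorm estimate
  keep the image inside the ball when \<open>v\<close> is close to \<open>g\<close>.\<close>

lemma continuous_map_compactly_supported_mult: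
  assumes K: "compact K" and \<theta>: "\<theta> \<in> smooth_functions" "\<And>x. x \<notin> K \<Longrightarrow> \<theta> x = 0"
  shows "continuous_map smooth_topology schwartz_topology (\<lambda>v x. \<theta> x * v x)"
proof -
  have schwartz: "(\<lambda>x. \<theta> x * v x) \<in> schwartz_functions" if "v \<in> smooth_functions" for v
    using compactly_supported_mult_schwartz[OF K \<theta>(1) _ that] \<theta>(2) by blast
  let ?\<B> = "{{g \<in> schwartz_functions. schwartz_seminorm i (\<lambda>x. g x - f x) < ennreal e} |f i e.
    f \<in> schwartz_functions \<and> i \<in> UNIV \<and> 0 < e}"
  show ?thesis
    unfolding schwartz_topology_def seminorm_topology_def
  proof (rule continuous_on_generated_topo)
    \<comment> \<open>Continuity into a generated topology includes that the subbase covers the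
      image; the unit ball around the image point itself does so.\<close>
    show "(\<lambda>v x. \<theta> x * v x) ` topspace smooth_topology \<subseteq> \<Union> ?\<B>"
    proof (rule image_subsetI)
      fix v assume "v \<in> topspace smooth_topology"
      then have v: "(\<lambda>x. \<theta> x * v x) \<in> schwartz_functions"
        by (simp add: schwartz)
      let ?B = "{g \<in> schwartz_functions. schwartz_seminorm 0 (\<lambda>x. g x - \<theta> x * v x) < ennreal 1}"
      have "?B \<in> ?\<B>"
        by (intro CollectI exI[of _ "\<lambda>x. \<theta> x * v x"] exI[of _ 0] exI[of _ 1]) (simp add: v)
      moreover have "(\<lambda>x. \<theta> x * v x) \<in> ?B"
        using v by (simp add: schwartz_seminorm_def higher_deriv_zero)
      ultimately show "(\<lambda>x. \<theta> x * v x) \<in> \<Union> ?\<B>"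
        by (rule UnionI)
    qed
  next
    fix U assume "U \<in> ?\<B>"
    then obtain f i e where f: "f \<in> schwartz_functions" and e: "0 < e"
      and U: "U = {g \<in> schwartz_functions. schwartz_seminorm i (\<lambda>x. g x - f x) < ennreal e}"
      by blast
    have f': "f \<in> smooth_functions"
      using f by (simp add: schwartz_functions_def)
    obtain C where C: "C \<ge> 0" "\<And>v. v \<in> smooth_functions \<Longrightarrow>
        schwartz_seminorm i (\<lambda>x. \<theta> x * v x) \<le> ennreal C * (\<Sum>k\<le>i. compact_seminorm (K, k) v)"
      using schwartz_seminorm_mult_le[OF assms] by blast
    show "openin smooth_topology ((\<lambda>v x. \<theta> x * v x) -` U \<inter> topspace smooth_topology)"
    proof (subst openin_subopen, intro ballI)
      fix g assume "g \<in> (\<lambda>v x. \<theta> x * v x) -` U \<inter> topspace smooth_topology"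
      then have g: "g \<in> smooth_functions"
        and ge: "schwartz_seminorm i (\<lambda>x. \<theta> x * g x - f x) < ennreal e"
        by (auto simp: U)
      \<comment> \<open>The ball is centered at \<open>f\<close>, not at the image of
        \<open>g\<close>, so the room left around that image is \<open>e - d\<close>.\<close>
      obtain d where d: "d \<ge> 0" "schwartz_seminorm i (\<lambda>x. \<theta> x * g x - f x) = ennreal d"
        using ge by (cases "schwartz_seminorm i (\<lambda>x. \<theta> x * g x - f x)") auto
      with ge have de: "d < e"
        by (simp add: ennreal_less_iff)
      \<comment> \<open>The \<open>Suc i\<close> seminorms of orders 0 to \<open>i\<close>
        contribute at most \<open>C * Suc i * \<delta>\<close>. The added 1 in the denominator makes
        this strictly less than \<open>e - d\<close>, also when \<open>C = 0\<close>.\<close>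
      define \<delta> where "\<delta> = (e - d) / (C * real (Suc i) + 1)"
      have den: "C * real (Suc i) + 1 > 0"
        using C(1) by (intro add_nonneg_pos mult_nonneg_nonneg) auto
      have \<delta>: "\<delta> > 0"
        unfolding \<delta>_def using de den by simp
      have \<delta>_less: "d + C * (real (Suc i) * \<delta>) < e"
      proof -
        have "e - d = \<delta> * (C * real (Suc i) + 1)"
          unfolding \<delta>_def using den by simp
        then show ?thesis
          using \<delta> by (simp add: algebra_simps)
      qed
      \<comment> \<open>The balls form only a subbase; the finite intersection over the orders
        \<open>k \<le> i\<close> is still open.\<close>
      define T where "T = (\<Inter>k\<in>{..i}. {v \<in> smooth_functions.
        compact_seminorm (K, k) (\<lambda>x. v x - g x) < ennreal \<delta>})"
      have "openin smooth_topology {v \<in> smooth_functions.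
          compact_seminorm (K, k) (\<lambda>x. v x - g x) < ennreal \<delta>}" for k
        unfolding smooth_topology_def seminorm_topology_def
        by (rule topology_generated_by_Basis) (use K g \<delta> in blast)
      then have "openin smooth_topology T"
        unfolding T_def by (intro openin_INT2) auto
      moreover have "compact_seminorm (K, k) (\<lambda>x. 0) = 0" for k
        by (auto simp: compact_seminorm_def higher_deriv_zero bot_ennreal SUP_constant)
      then have "g \<in> T"
        using g \<delta> by (simp add: T_def)
      moreover have "v \<in> (\<lambda>v x. \<theta> x * v x) -` U \<inter> topspace smooth_topology" if "v \<in> T" for v
      proof -
        have v: "v \<in> smooth_functions"
          and v_less: "\<And>k. k \<le> i \<Longrightarrow> compact_seminorm (K, k) (\<lambda>x. v x - g x) < ennreal \<delta>"
          using that by (auto simp: T_def)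
        have "schwartz_seminorm i (\<lambda>x. \<theta> x * v x - f x) =
            schwartz_seminorm i (\<lambda>x. (\<theta> x * g x - f x) + \<theta> x * (v x - g x))"
          by (simp add: algebra_simps)
        also have "\<dots> \<le> schwartz_seminorm i (\<lambda>x. \<theta> x * g x - f x) +
            schwartz_seminorm i (\<lambda>x. \<theta> x * (v x - g x))"
          by (intro schwartz_seminorm_triangle smooth_diff smooth_mult \<theta>(1) g v f')
        also have "\<dots> \<le> ennreal d + ennreal C * (\<Sum>k\<le>i. ennreal \<delta>)"
          unfolding d(2)
          by (intro add_left_mono order_trans[OF C(2)] mult_left_mono sum_mono
              less_imp_le[OF v_less] smooth_diff v g) auto
        also have "\<dots> = ennreal (d + C * (real (Suc i) * \<delta>))"
          using C(1) d(1) \<delta>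
          by (subst ennreal_plus) (simp_all add: ennreal_mult ennreal_of_nat_eq_real_of_nat del: of_nat_Suc)
        also have "\<dots> < ennreal e"
          by (rule ennreal_lessI[OF e \<delta>_less])
        finally show ?thesis
          using schwartz[OF v] v by (simp add: U)
      qed
      ultimately show "\<exists>T. openin smooth_topology T \<and> g \<in> T \<and>
          T \<subseteq> (\<lambda>v x. \<theta> x * v x) -` U \<inter> topspace smooth_topology"
        by blast
    qed
  qed
qed

section \<open>Properness of symbols\<close>

lemma smooth_cutoff_schwartz:
  assumes "\<kappa> \<in> smooth_functions" and "\<And>y. \<bar>y\<bar> \<ge> r \<Longrightarrow> \<kappa> y = 0" and "f \<in> smooth_functions"
  shows "(\<lambda>y. \<kappa> y * f y) \<in> schwartz_functions"
proof (rule compactly_supported_mult_schwartz[where K = "{-r..r}"])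
  show "\<kappa> x = 0" if "x \<notin> {-r..r}" for x
    using that by (intro assms(2)) auto
qed (use assms in auto)

lemma compact_vimage_schwartz_symbol:
  assumes "schwartz_symbol \<phi>"
  shows "compact {x. \<bar>\<phi> x\<bar> \<le> r}"
proof -
  obtain \<kappa> where \<kappa>: "\<kappa> \<in> smooth_functions" "\<And>y. \<bar>y\<bar> \<le> r \<Longrightarrow> \<kappa> y = 1"
      "\<And>y. \<bar>y\<bar> \<ge> r + 1 \<Longrightarrow> \<kappa> y = 0"
    using exists_smooth_cutoff by blast
  have "\<kappa> \<in> schwartz_functions"
    using smooth_cutoff_schwartz[OF \<kappa>(1,3) smooth_const[of 1]] by simp
  then have "\<kappa> \<circ> \<phi> \<in> schwartz_functions"
    using assms by (simp add: schwartz_symbol_def)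
  then have "schwartz_seminorm 1 (\<kappa> \<circ> \<phi>) < \<infinity>"
    by (simp add: schwartz_functions_def)
  then obtain C where C: "C \<ge> 0" "schwartz_seminorm 1 (\<kappa> \<circ> \<phi>) = ennreal C"
    by (cases "schwartz_seminorm 1 (\<kappa> \<circ> \<phi>)") auto
  have "\<bar>x\<bar> \<le> 1 + C" if "\<bar>\<phi> x\<bar> \<le> r" for x
  proof -
    \<comment> \<open>The term of order 0 in the first seminorm. Since
      \<open>\<kappa> (\<phi> x) = 1\<close> here, it equals the weight \<open>1 + x^2\<close>,
      which is thus bounded by \<open>C\<close>.\<close>
    have "ennreal ((1 + \<bar>x\<bar>\<^sup>2) ^ 1 * \<bar>(deriv ^^ 0) (\<kappa> \<circ> \<phi>) x\<bar>) \<le> ennreal C"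
      unfolding C(2)[symmetric] schwartz_seminorm_def by (rule SUP_upper2[OF UNIV_I], rule SUP_upper) simp
    then have "1 + \<bar>x\<bar>\<^sup>2 \<le> C"
      unfolding ennreal_le_iff[OF C(1)] using \<kappa>(2)[OF that] by simp
    moreover have "\<bar>x\<bar> \<le> 1 + \<bar>x\<bar>\<^sup>2"
      using self_le_power[of "\<bar>x\<bar>" 2] by (cases "\<bar>x\<bar> \<ge> 1") (auto intro: add_increasing2)
    ultimately show ?thesis by linarith
  qed
  then have "bounded {x. \<bar>\<phi> x\<bar> \<le> r}"
    unfolding bounded_iff by (intro exI[of _ "1 + C"]) auto
  moreover have "closed {x. \<bar>\<phi> x\<bar> \<le> r}"
    using assms by (intro closed_Collect_le continuous_intros continuous_on_smooth)
      (simp add: schwartz_symbol_def)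
  ultimately show ?thesis
    by (simp add: compact_eq_bounded_closed)
qed

section \<open>Gluing the local factors\<close>

text \<open>The \<open>h n\<close> are tied to each other only on the range of \<open>\<phi>\<close>
  and may differ elsewhere, so they are blended by cutoffs. Blending is harmless: where two
  functions both give \<open>g\<close> after composition with \<open>\<phi>\<close>, so does a
  combination whose weights sum to 1.\<close>

lemma smooth_factorization_from_bounded_pieces:
  fixes \<phi> :: "'a \<Rightarrow> real"
  assumes h: "\<And>n. h n \<in> smooth_functions"
    and eq: "\<And>n x. \<bar>\<phi> x\<bar> \<le> real n \<Longrightarrow> h n (\<phi> x) = g x"
  shows "\<exists>F\<in>smooth_functions. F \<circ> \<phi> = g"
proof -
  obtain \<kappa> where \<kappa>: "\<And>n. \<kappa> n \<in> smooth_functions" "\<And>n y. \<bar>y\<bar> \<le> real n \<Longrightarrow> \<kappa> n y = 1"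
      "\<And>n y. \<bar>y\<bar> \<ge> real n + 1 \<Longrightarrow> \<kappa> n y = 0"
    using exists_smooth_cutoff[of "real n" for n] by metis
  \<comment> \<open>\<open>F (Suc n)\<close> agrees with \<open>F n\<close> on \<open>[-n, n]\<close>. The index \<open>n + 2\<close> lets the invariant \<open>F n \<circ> \<phi> = g\<close>
    where \<open>\<bar>\<phi>\<bar> \<le> n + 1\<close> survive on the transition region of \<open>\<kappa> n\<close>.\<close>
  define F where "F = rec_nat (h 1) (\<lambda>n u y. \<kappa> n y * u y + (1 - \<kappa> n y) * h (n + 2) y)"
  have F_0: "F 0 = h 1" and F_Suc: "\<And>n. F (Suc n) = (\<lambda>y. \<kappa> n y * F n y + (1 - \<kappa> n y) * h (n + 2) y)"
    by (simp_all add: F_def)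
  have F_smooth: "F n \<in> smooth_functions" for n
    by (induction n)
      (auto simp: F_0 F_Suc intro!: smooth_add smooth_mult smooth_diff smooth_const h \<kappa>)
  have F_eq: "F n (\<phi> x) = g x" if "\<bar>\<phi> x\<bar> \<le> real n + 1" for n x
    using that
  proof (induction n)
    case 0
    then show ?case using eq[of x 1] by (simp add: F_0)
  next
    case (Suc n)
    have "h (n + 2) (\<phi> x) = g x"
      using Suc.prems by (intro eq) auto
    \<comment> \<open>If \<open>\<bar>\<phi> x\<bar> \<le> n + 1\<close>, both blended functions
      give \<open>g x\<close>. Otherwise \<open>\<kappa> n\<close> vanishes at
      \<open>\<phi> x\<close> and only \<open>h (n + 2)\<close> remains.\<close>
    then show ?case
      using Suc.IH \<kappa>(3)[of n "\<phi> x"]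
      by (cases "\<bar>\<phi> x\<bar> \<le> real n + 1") (auto simp: F_Suc algebra_simps)
  qed
  have F_stable: "F m y = F n y" if "\<bar>y\<bar> \<le> real n" "n \<le> m" for m n y
    using that(2,1)
    by (induction m rule: dec_induct) (auto simp: F_Suc \<kappa>(2))
  \<comment> \<open>The sequence \<open>F n y\<close> is constant once
    \<open>n \<ge> \<bar>y\<bar>\<close>; \<open>L\<close> takes this eventual value.\<close>
  define L where "L y = F (nat \<lceil>\<bar>y\<bar>\<rceil>) y" for y
  have L_eq: "L y = F n y" if "\<bar>y\<bar> \<le> real n" for n y
    unfolding L_def using that by (intro F_stable[symmetric]) linarith+
  have "L \<in> smooth_functions"
  proof (rule smooth_if_locally_smooth)
    fix x :: real
    \<comment> \<open>The added 1 puts \<open>x\<close> in the interior of \<open>[-n, n]\<close>,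
      so that \<open>L\<close> equals the single function \<open>F n\<close> near
      \<open>x\<close>.\<close>
    define n where "n = nat \<lceil>\<bar>x\<bar>\<rceil> + 1"
    have "x \<in> {- real n<..<real n}"
      unfolding n_def by auto linarith+
    then have "\<forall>\<^sub>F y in nhds x. y \<in> {- real n<..<real n}"
      by (intro eventually_nhds_in_open) auto
    then have "\<forall>\<^sub>F y in nhds x. L y = F n y"
      by (rule eventually_mono) (intro L_eq, auto)
    then show "\<exists>g\<in>smooth_functions. \<forall>\<^sub>F y in nhds x. L y = g y"
      using F_smooth by blast
  qed
  moreover have "L (\<phi> x) = g x" for x
  proof -
    have "\<bar>\<phi> x\<bar> \<le> real (nat \<lceil>\<bar>\<phi> x\<bar>\<rceil>)"
      by linarith
    then show ?thesis
      unfolding L_def by (intro F_eq) linarith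
  qed
  ultimately show ?thesis
    by (intro bexI[of _ L]) auto
qed

section \<open>Closedness of the range on the smooth functions\<close>

theorem lemma4p1:
  fixes \<phi> :: "real \<Rightarrow> real"
  assumes "schwartz_symbol \<phi>"
    and "has_closed_range schwartz_topology schwartz_topology (composition_operator \<phi>)"
  shows "has_closed_range smooth_topology smooth_topology (composition_operator \<phi>)"
proof -
  define R where "R = composition_operator \<phi> ` schwartz_functions"
  have R: "closedin schwartz_topology R"
    using assms(2) by (simp add: has_closed_range_def R_def)
  have \<phi>: "\<phi> \<in> smooth_functions"
    using assms(1) by (simp add: schwartz_symbol_def)
  obtain \<kappa> where \<kappa>: "\<And>n. \<kappa> n \<in> smooth_functions" "\<And>n y. \<bar>y\<bar> \<le> real n \<Longrightarrow> \<kappa> n y = 1"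
      "\<And>n y. \<bar>y\<bar> \<ge> real n + 1 \<Longrightarrow> \<kappa> n y = 0"
    using exists_smooth_cutoff[of "real n" for n] by metis
  define M where "M = (\<lambda>n v x. \<kappa> n (\<phi> x) * v x)"
  have "continuous_map smooth_topology schwartz_topology (M n)" for n
    unfolding M_def
  proof (rule continuous_map_compactly_supported_mult)
    \<comment> \<open>Outside this set \<open>\<kappa> n \<circ> \<phi>\<close> vanishes, and
      properness of \<open>\<phi>\<close> makes the set compact.\<close>
    show "compact {x. \<bar>\<phi> x\<bar> \<le> real n + 1}"
      by (rule compact_vimage_schwartz_symbol[OF assms(1)])
  qed (auto intro: smooth_compose \<kappa> \<phi>)
  then have closed: "closedin smooth_topology {g \<in> smooth_functions. M n g \<in> R}" for n
    using closedin_continuous_map_preimage[OF _ R] by fastforce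
  have "composition_operator \<phi> ` smooth_functions = (\<Inter>n. {g \<in> smooth_functions. M n g \<in> R})"
  proof (intro equalityI subsetI)
    fix g assume "g \<in> composition_operator \<phi> ` smooth_functions"
    then obtain f where f: "f \<in> smooth_functions" "g = f \<circ> \<phi>"
      by (auto simp: composition_operator_def)
    \<comment> \<open>The multiplier is itself a function of \<open>\<phi>\<close>, so it can be
      moved onto \<open>f\<close>, where it cuts \<open>f\<close> down to a Schwartz
      function.\<close>
    have "M n g = composition_operator \<phi> (\<lambda>y. \<kappa> n y * f y)" for n
      by (auto simp: M_def f(2) composition_operator_def)
    moreover have "(\<lambda>y. \<kappa> n y * f y) \<in> schwartz_functions" for n
      by (rule smooth_cutoff_schwartz[OF \<kappa>(1,3) f(1)])
    moreover have "g \<in> smooth_functions"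
      using smooth_compose[OF f(1) \<phi>] by (simp add: f(2) comp_def)
    ultimately show "g \<in> (\<Inter>n. {g \<in> smooth_functions. M n g \<in> R})"
      by (auto simp: R_def)
  next
    fix g assume "g \<in> (\<Inter>n. {g \<in> smooth_functions. M n g \<in> R})"
    then have "\<forall>n. \<exists>h\<in>schwartz_functions. M n g = h \<circ> \<phi>"
      by (auto simp: R_def composition_operator_def)
    then obtain h where h: "\<And>n. h n \<in> schwartz_functions" "\<And>n. M n g = h n \<circ> \<phi>"
      by metis
    \<comment> \<open>The multiplier equals 1 at such \<open>x\<close>, so the factorization of
      \<open>M n g\<close> is there one of \<open>g\<close>.\<close>
    have "h n (\<phi> x) = g x" if "\<bar>\<phi> x\<bar> \<le> real n" for n x
      using fun_cong[OF h(2), of n x] \<kappa>(2)[OF that] by (simp add: M_def)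
    moreover have "h n \<in> smooth_functions" for n
      using h(1) by (simp add: schwartz_functions_def)
    ultimately have "\<exists>F\<in>smooth_functions. F \<circ> \<phi> = g"
      by (intro smooth_factorization_from_bounded_pieces) auto
    then show "g \<in> composition_operator \<phi> ` smooth_functions"
      by (auto simp: composition_operator_def)
  qed
  then show ?thesis
    unfolding has_closed_range_def using closed by (auto intro!: closedin_INT)
qed

end
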